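(* Up to rigid motions, there is exactly one pair of amicable lattice triangles. That is, there exist non-congruent lattice triangles $T_1, T_2$ such that $(T_1,T_2)$ is amicable, and whenever $T_1', T_2'$ are non-congruent lattice triangles such that $(T_1',T_2')$ is amicable, either $T_1'$ is congruent to $T_1$ and $T_2'$ is congruent to $T_2$, or $T_1'$ is congruent to $T_2$ and $T_2'$ is congruent to $T_1$.
   Context: All polygons are (non-degenerate) polygons in the Euclidean plane $\mathbb{R}^2$. A lattice polygon (in particular a lattice triangle) is a polygon all of whose vertices lie in the integer lattice $\mathbb{Z}^2$. Two polygons are amicable if the area of the first equals the perimeter of the second and the perimeter of the first equals the area of the second. It is a standing assumption that the two polygons of an amicable pair are not the same, i.e. not congruent. Congruent means related by a rigid motion, i.e. an isometry of $\mathbb{R}^2$ (reflections allowed); each polygon of a pair may be moved independently, and pairs are unordered. *)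

theory Defs
  imports "HOL-Analysis.Analysis"
begin

definition lattice_point :: "real ^ 2 \<Rightarrow> bool" where
  "lattice_point p \<longleftrightarrow> (\<forall>i. p $ i \<in> \<int>)"

(* A triangle is the solid planar region spanned by its three vertices, which need not be ordered. *)
definition lattice_triangle :: "(real ^ 2) set \<Rightarrow> bool" where
  "lattice_triangle T \<longleftrightarrow>
     (\<exists>a b c. lattice_point a \<and> lattice_point b \<and> lattice_point c \<and>
              \<not> collinear {a, b, c} \<and> T = convex hull {a, b, c})"

definition area :: "(real ^ 2) set \<Rightarrow> real" where
  "area T = measure lborel T"

(* For convex polygons only: their edges are the one-dimensional faces, which are segments,
   and the diameter of a segment is its length.  See perimeter_triangle below. *)
definition perimeter :: "(real ^ 2) set \<Rightarrow> real" where
  "perimeter T = (\<Sum>e | e edge_of T. diameter e)"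

(* Reflections are allowed.  Surjectivity of f need not be required: a distance-preserving
   self-map of the plane is automatically bijective. *)
definition congruent_figures :: "(real ^ 2) set \<Rightarrow> (real ^ 2) set \<Rightarrow> bool" where
  "congruent_figures S T \<longleftrightarrow>
     (\<exists>f :: real ^ 2 \<Rightarrow> real ^ 2. (\<forall>x y. dist (f x) (f y) = dist x y) \<and> f ` S = T)"

definition amicable :: "(real ^ 2) set \<Rightarrow> (real ^ 2) set \<Rightarrow> bool" where
  "amicable S T \<longleftrightarrow> area S = perimeter T \<and> perimeter S = area T"

lemma diameter_segment:
  fixes a b :: "real ^ 2"
  shows "diameter (convex hull {a, b}) = dist a b"
proof (rule antisym)
  show "diameter (convex hull {a, b}) \<le> dist a b"
  proof (rule diameter_le)
    fix x y assume "x \<in> convex hull {a, b}" "y \<in> convex hull {a, b}"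
    then obtain u v where "u \<in> {a, b}" "v \<in> {a, b}" and le: "norm (x - y) \<le> norm (u - v)"
      using simplex_extremal_le_exists [of "{a, b}" x y] by blast
    then have "norm (u - v) \<le> dist a b"
      by (auto simp: dist_norm norm_minus_commute)
    with le show "norm (x - y) \<le> dist a b" by linarith
  qed simp
  have "bounded (convex hull {a, b})"
    by (simp add: finite_imp_bounded_convex_hull)
  moreover have "a \<in> convex hull {a, b}" "b \<in> convex hull {a, b}"
    by (simp_all add: hull_inc)
  ultimately show "dist a b \<le> diameter (convex hull {a, b})"
    by (rule diameter_bounded_bound)
qed

lemma edge_of_triangle_iff:
  fixes a b c :: "real ^ 2"
  assumes "\<not> collinear {a, b, c}"
  shows "e edge_of convex hull {a, b, c} \<longleftrightarrow>
         e \<in> {convex hull {a, b}, convex hull {b, c}, convex hull {c, a}}"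
proof -
  have ne: "a \<noteq> b" "b \<noteq> c" "a \<noteq> c" and ind: "\<not> affine_dependent {a, b, c}"
    using assms unfolding collinear_3_eq_affine_dependent by blast+
  have subset_iff: "s \<subseteq> {a, b, c} \<and> aff_dim s = 1 \<longleftrightarrow> s \<in> {{a, b}, {b, c}, {c, a}}" for s
  proof
    assume s: "s \<subseteq> {a, b, c} \<and> aff_dim s = 1"
    then have "int (card s) = aff_dim s + 1"
      using ind affine_independent_subset aff_dim_affine_independent by metis
    with s have "card s = 2" by simp
    then obtain x y where "s = {x, y}" "x \<noteq> y"
      by (auto simp: card_2_iff)
    with s show "s \<in> {{a, b}, {b, c}, {c, a}}" by auto
  qed (use ne in auto)
  have "e edge_of convex hull {a, b, c} \<longleftrightarrow>
        (\<exists>s. (s \<subseteq> {a, b, c} \<and> aff_dim s = 1) \<and> e = convex hull s)"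
    unfolding edge_of_def face_of_convex_hull_affine_independent [OF ind]
    by (metis aff_dim_convex_hull)
  then show ?thesis
    unfolding subset_iff by blast
qed

lemma perimeter_triangle:
  fixes a b c :: "real ^ 2"
  assumes "\<not> collinear {a, b, c}"
  shows "perimeter (convex hull {a, b, c}) = dist a b + dist b c + dist c a"
proof -
  have ne: "a \<noteq> b" "b \<noteq> c" "a \<noteq> c"
    using assms unfolding collinear_3_eq_affine_dependent by blast+
  have "{e. e edge_of convex hull {a, b, c}} =
        {convex hull {a, b}, convex hull {b, c}, convex hull {c, a}}"
    using edge_of_triangle_iff [OF assms] by blast
  moreover have "convex hull {a, b} \<noteq> convex hull {b, c}"
      "convex hull {b, c} \<noteq> convex hull {c, a}" "convex hull {a, b} \<noteq> convex hull {c, a}"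
    using ne unfolding segment_convex_hull [symmetric] closed_segment_eq doubleton_eq_iff by blast+
  ultimately show ?thesis
    by (simp add: perimeter_def diameter_segment)
qed

end

theory Submission
  imports Defs
begin

text \<open>Rational perimeters force the sides of both triangles to be integers and the perimeters to be
  even, so that with the tangent lengths x, y, z and u, v, w (the distances from the vertices to the
  points of contact of the incircle) Heron's formula turns amicability into
  s x y z = 4 t^2 and t u v w = 4 s^2, where s = x + y + z and t = u + v + w.
  For s \<ge> t and x \<le> y \<le> z the first equation gives x y z \<le> 4 s, hence x y \<le> 12, and z is
  bounded as well unless x y \<le> 4. There the first equation has no or few solutions by comparison with
  consecutive squares, except for (x, y) = (1, 2) and (1, 3), where it is a Pell equation; then s / t
  is nearly constant, so the second equation bounds u v and in turn w, t and z. A finite search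
  leaves the sides (3, 25, 26) and (9, 12, 15), apart from pairs of congruent triangles.\<close>

subsection \<open>The Diophantine system\<close>

text \<open>Conditionals replace implications because code_simp simplifies their branches only after the
  condition has been decided.\<close>

lemma tangent_lengths_small:
  "list_all (\<lambda>x. list_all (\<lambda>y. if x * y \<le> 4 then True else
      list_all (\<lambda>z. let s = x + y + z in if x * y * z \<le> 4 * s then
        list_all (\<lambda>t. if s * (x * y * z) = 4 * t\<^sup>2
          then (x, y, z, t) \<in> set [(1, 5, 24, 30), (1, 6, 14, 21), (1, 8, 9, 18),
            (2, 3, 3, 6), (2, 3, 10, 15), (2, 4, 6, 12)]
          else True) [1..s] else True)
      [y..52]) [x..12]) [1..3::int]"
  by code_simp

text \<open>The case \<open>x = 1\<close>, \<open>y = 2\<close>. Since 1 / sqrt 2 lies between 7/10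
  and 71/100, \<open>t\<close> is confined to a short interval for each \<open>z\<close>; the
  summand 2 absorbs the linear term \<open>3 * z\<close>.\<close>

lemma pell_2_small:
  "list_all (\<lambda>z. list_all (\<lambda>t. if z * (z + 3) = 2 * t\<^sup>2
      then (z, t) \<in> set [(3, 3), (24, 18), (147, 105)] else True)
    [7 * z div 10..71 * z div 100 + 2]) [1..346::int]"
  by code_simp

text \<open>The case \<open>x = 1\<close>, \<open>y = 3\<close>, with 86/100 and 87/100 as bounds
  for sqrt 3 / 2; \<open>z\<close> starts at 3 because \<open>y \<le> z\<close>.\<close>

lemma pell_3_small:
  "list_all (\<lambda>z. list_all (\<lambda>t. if 3 * (z * (z + 4)) = 4 * t\<^sup>2
      then (z, t) \<in> set [(12, 12), (50, 45), (192, 168)] else True)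
    [86 * z div 100..87 * z div 100 + 2]) [3..250::int]"
  by code_simp

text \<open>The pairs \<open>(s, t)\<close> are the semiperimeters of those solutions of the first
  equation for which \<open>t\<close> divides \<open>4 * s^2\<close>; \<open>L\<close> collects the
  triples that also solve the second. The ranges come from \<open>u \<le> v \<le> w\<close>. Where
  \<open>s = t\<close>, only the tangent lengths of the first triangle recur.\<close>

lemma second_triangle_small:
  "list_all (\<lambda>(s, t, L). list_all (\<lambda>u. list_all (\<lambda>v.
      if t * (u * v * (t - u - v)) = 4 * s\<^sup>2 \<and> v \<le> t - u - v
      then (u, v, t - u - v) \<in> set L else True) [u..t div 2]) [1..t div 3])
    [(6, 3, []), (27, 18, [(3, 6, 9)]), (9, 6, []), (30, 30, [(1, 5, 24)]), (21, 21, [(1, 6, 14)]),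
     (18, 18, [(1, 8, 9)]), (15, 15, [(2, 3, 10)]), (12, 12, [(2::int, 4::int, 6::int)])]"
  by code_simp

section \<open>Bounds in the two Pell cases\<close>

text \<open>Eliminating \<open>t^2\<close> gives \<open>z * (u * v * w) = 8 * (z + 3) * t\<close>,
  so \<open>u * v\<close> is close to \<open>8 * t / w\<close>. As \<open>w < t \<le> 3 * w\<close>,
  large \<open>z\<close> forces \<open>u * v\<close> between 9 and 24. The same equation, solved for
  \<open>w\<close>, then bounds \<open>w\<close> by a constant, hence also \<open>t\<close>, against
  the growth of \<open>t\<close> with \<open>z\<close>.\<close>

lemma semiperimeter_bound_1_2:
  fixes z t u v w :: int
  assumes pos: "0 < z" "0 < t" "0 < u" "u \<le> v" "v \<le> w"
    and t: "t = u + v + w"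
    and area: "z * (z + 3) = 2 * t\<^sup>2"
    and area': "t * (u * v * w) = 4 * (z + 3)\<^sup>2"
  shows "z \<le> 346"
proof (rule ccontr)
  assume "\<not> z \<le> 346"
  then have z: "z \<ge> 347" by simp
  have "t * (z * (u * v * w)) = z * (t * (u * v * w))" by algebra
  also have "\<dots> = 4 * (z + 3) * (z * (z + 3))" unfolding area' by algebra
  also have "\<dots> = t * ((8 * z + 24) * t)" unfolding area by algebra
  finally have eq: "z * (u * v * w) = (8 * z + 24) * t"
    using pos by simp
  have "z * (u * v) * w = (8 * z + 24) * t" using eq by (simp add: mult_ac)
  also have "\<dots> \<le> (8 * z + 24) * (3 * w)"
    using t pos by (intro mult_left_mono) auto
  finally have "z * (u * v) \<le> (8 * z + 24) * 3"
    using pos by (simp add: mult.assoc [symmetric])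
  also have "\<dots> < z * 25" using z by simp
  finally have "u * v < 25" using pos by (simp only: mult_less_cancel_left_pos)
  then have uv: "u * v \<le> 24" by simp
  have "(8 * z) * w < (8 * z + 24) * t"
    using t pos by (intro mult_strict_mono) auto
  then have "z * w * 8 < z * w * (u * v)" using eq by (simp add: mult_ac)
  then have uv': "u * v \<ge> 9" using pos by simp
  have "0 \<le> (u - 1) * (v - 1)" using pos by simp
  then have sum: "u + v \<le> 25" using uv by (simp add: algebra_simps)
  \<comment> \<open>Substituting \<open>t = u + v + w\<close> and collecting the terms with
    \<open>w\<close> leaves \<open>u + v\<close> on the right, which is at most
    \<open>u * v + 1\<close>.\<close>
  have "w * (z - 24) \<le> w * (z * (u * v - 8) - 24)"
  proof -
    have "z * 1 \<le> z * (u * v - 8)" using uv' pos by (intro mult_left_mono) auto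
    then show ?thesis using pos by (intro mult_left_mono) auto
  qed
  also have "\<dots> = (8 * z + 24) * (u + v)" using eq unfolding t by algebra
  also have "\<dots> \<le> (8 * z + 24) * 25" using sum pos by (intro mult_left_mono) auto
  finally have w: "w * (z - 24) \<le> (8 * z + 24) * 25" .
  have "w \<le> 220"
  proof (rule ccontr)
    assume "\<not> w \<le> 220"
    then have "221 * (z - 24) \<le> w * (z - 24)" using z by (intro mult_right_mono) auto
    with w z show False by simp
  qed
  then have "t \<le> 245" using t sum by simp
  then have "t\<^sup>2 \<le> 245\<^sup>2" using pos by (intro power_mono) auto
  \<comment> \<open>347 * 350 = 121450 exceeds 2 * 245^2 = 120050.\<close>
  moreover have "347 * 350 \<le> z * (z + 3)" using z by (intro mult_mono) auto
  ultimately show False using area by simp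
qed

text \<open>As for \<open>y = 2\<close>, with \<open>u * v\<close> now close to
  \<open>16 * t / (3 * w)\<close>: it exceeds 16/3 and is below 17, so it lies between 6 and 16, and
  \<open>3 * (u * v) - 16\<close> is at least 2.\<close>

lemma semiperimeter_bound_1_3:
  fixes z t u v w :: int
  assumes pos: "0 < z" "0 < t" "0 < u" "u \<le> v" "v \<le> w"
    and t: "t = u + v + w"
    and area: "3 * (z * (z + 4)) = 4 * t\<^sup>2"
    and area': "t * (u * v * w) = 4 * (z + 4)\<^sup>2"
  shows "z \<le> 250"
proof (rule ccontr)
  assume "\<not> z \<le> 250"
  then have z: "z \<ge> 251" by simp
  have "t * (3 * z * (u * v * w)) = 3 * z * (t * (u * v * w))" by algebra
  also have "\<dots> = 4 * (z + 4) * (3 * (z * (z + 4)))" unfolding area' by algebra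
  also have "\<dots> = t * ((16 * z + 64) * t)" unfolding area by algebra
  finally have eq: "3 * z * (u * v * w) = (16 * z + 64) * t"
    using pos by simp
  have "3 * z * (u * v) * w = (16 * z + 64) * t" using eq by (simp add: mult_ac)
  also have "\<dots> \<le> (16 * z + 64) * (3 * w)"
    using t pos by (intro mult_left_mono) auto
  finally have "3 * z * (u * v) \<le> (16 * z + 64) * 3"
    using pos by (simp add: mult.assoc [symmetric])
  then have "3 * (z * (u * v)) \<le> 3 * (16 * z + 64)" by (simp only: mult_ac)
  then have "z * (u * v) \<le> 16 * z + 64" by (simp only: mult_le_cancel_left_pos zero_less_numeral)
  also have "\<dots> < z * 17" using z by simp
  finally have "u * v < 17" using pos by (simp only: mult_less_cancel_left_pos)
  then have uv: "u * v \<le> 16" by simp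
  have "(16 * z) * w < (16 * z + 64) * t"
    using t pos by (intro mult_strict_mono) auto
  then have "z * w * 16 < z * w * (3 * (u * v))" using eq by (simp add: mult_ac)
  then have "16 < 3 * (u * v)" using pos by (simp only: mult_less_cancel_left_pos mult_pos_pos)
  then have uv': "u * v \<ge> 6" by simp
  have "0 \<le> (u - 1) * (v - 1)" using pos by simp
  then have sum: "u + v \<le> 17" using uv by (simp add: algebra_simps)
  have "w * (2 * z - 64) \<le> w * (z * (3 * (u * v) - 16) - 64)"
  proof -
    have "z * 2 \<le> z * (3 * (u * v) - 16)" using uv' pos by (intro mult_left_mono) auto
    then show ?thesis using pos by (intro mult_left_mono) auto
  qed
  also have "\<dots> = (16 * z + 64) * (u + v)" using eq unfolding t by algebra
  also have "\<dots> \<le> (16 * z + 64) * 17" using sum pos by (intro mult_left_mono) auto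
  finally have w: "w * (2 * z - 64) \<le> (16 * z + 64) * 17" .
  have "w < 200"
  proof (rule ccontr)
    assume "\<not> w < 200"
    then have "200 * (2 * z - 64) \<le> w * (2 * z - 64)" using z by (intro mult_right_mono) auto
    with w z show False by simp
  qed
  then have "t \<le> 216" using t sum by simp
  then have "t\<^sup>2 \<le> 216\<^sup>2" using pos by (intro power_mono) auto
  \<comment> \<open>3 * 251 * 255 = 192015 exceeds 4 * 216^2 = 186624.\<close>
  moreover have "251 * 255 \<le> z * (z + 4)" using z by (intro mult_mono) auto
  ultimately show False using area by simp
qed

section \<open>Solution of the Diophantine system\<close>

text \<open>These are candidates only: the second equation enters just to bound \<open>z\<close> in
  the Pell cases, where the first alone has infinitely many solutions. It is exploited fully in
  \<open>amicable_tangent_lengths\<close>.\<close>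

lemma tangent_lengths_cases:
  fixes x y z t u v w :: int
  assumes pos: "0 < x" "x \<le> y" "y \<le> z" "0 < u" "u \<le> v" "v \<le> w"
    and t: "t = u + v + w" and le: "t \<le> x + y + z"
    and area: "(x + y + z) * (x * y * z) = 4 * t\<^sup>2"
    and area': "t * (u * v * w) = 4 * (x + y + z)\<^sup>2"
  shows "(x, y, z, t) \<in> {(1, 2, 3, 3), (1, 2, 24, 18), (1, 2, 147, 105), (1, 3, 12, 12),
    (1, 3, 50, 45), (1, 3, 192, 168), (1, 4, 4, 6), (1, 5, 24, 30), (1, 6, 14, 21), (1, 8, 9, 18),
    (2, 3, 3, 6), (2, 3, 10, 15), (2, 4, 6, 12)}"
proof -
  have t0: "t > 0" using t pos by simp
  have "t\<^sup>2 \<le> (x + y + z)\<^sup>2" using le t0 by (intro power_mono) auto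
  then have "(x + y + z) * (x * y * z) \<le> (x + y + z) * (4 * (x + y + z))"
    unfolding area by (simp only: power2_eq_square mult.left_commute mult_left_mono zero_le_numeral)
  then have xyz: "x * y * z \<le> 4 * (x + y + z)" using pos by simp
  also have "\<dots> \<le> 12 * z" using pos by simp
  finally have xy: "x * y \<le> 12" using pos by simp
  have x3: "x \<le> 3"
  proof (rule ccontr)
    assume "\<not> x \<le> 3"
    then have "4 * 4 \<le> x * y" using pos by (intro mult_mono) auto
    with xy show False by simp
  qed
  have "1 * y \<le> x * y" using pos by (intro mult_right_mono) auto
  with xy have y12: "y \<le> 12" by simp
  show ?thesis
  proof (cases "x * y \<le> 4")
    case False
    then have "1 * z \<le> (x * y - 4) * z" using pos by (intro mult_right_mono) auto
    also have "\<dots> \<le> 4 * (x + y)" using xyz by (simp add: algebra_simps)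
    also have "x + y \<le> 13"
      using mult_nonneg_nonneg [of "x - 1" "y - 1"] pos xy by (simp add: algebra_simps)
    finally have z: "z \<le> 52" by simp
    have "x \<in> {1..3}" "y \<in> {x..12}" "z \<in> {y..52}" "t \<in> {1..x + y + z}"
      using pos x3 y12 z t0 le by auto
    \<comment> \<open>Each \<open>bspec\<close> instantiates one quantifier of the evaluated search;
      each \<open>if_P\<close> or \<open>if_not_P\<close> selects the branch of a
      conditional.\<close>
    note small = bspec [OF bspec [OF tangent_lengths_small [unfolded list_all_iff set_upto Let_def]
      this(1)] this(2)] this(3,4)
    note small = bspec [OF iffD1 [OF if_not_P [OF False] small(1)] small(2)] small(3)
    note small = bspec [OF iffD1 [OF if_P [OF xyz] small(1)] small(2)]
    note small = iffD1 [OF if_P [OF area] small]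
    then show ?thesis by auto
  next
    case True
    have "y * 1 \<le> 4" using True \<open>1 * y \<le> x * y\<close> by simp
    then have "y \<in> {1, 2, 3, 4}" "x \<in> {1, 2, 3}" using pos x3 by auto
    then consider "x = 1" "y = 1" | "x = 1" "y = 2" | "x = 1" "y = 3" | "x = 1" "y = 4"
      | "x = 2" "y = 2"
      using True pos by auto
    then show ?thesis
    proof cases
      case 1
      then have eq: "(2 * t)\<^sup>2 = z * (z + 2)" using area by (simp add: algebra_simps)
      have "z\<^sup>2 < (2 * t)\<^sup>2" "(2 * t)\<^sup>2 < (z + 1)\<^sup>2"
        unfolding eq using pos by (simp_all add: power2_eq_square algebra_simps)
      then have "z < 2 * t" "2 * t < z + 1"
        using power2_less_imp_less [of z "2 * t"] power2_less_imp_less [of "2 * t" "z + 1"] pos t0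
        by auto
      then show ?thesis by simp
    next
      case 2
      then have eq: "z * (z + 3) = 2 * t\<^sup>2" using area by (simp add: algebra_simps)
      have z: "z \<le> 346"
        by (rule semiperimeter_bound_1_2 [of z t u v w]) (use pos t t0 eq area' 2 in \<open>auto simp: add.commute\<close>)
      have sq: "(7 * z)\<^sup>2 = 49 * z\<^sup>2" "(10 * t)\<^sup>2 = 100 * t\<^sup>2" "(100 * t)\<^sup>2 = 10000 * t\<^sup>2"
          "(71 * z + 200)\<^sup>2 = 5041 * z\<^sup>2 + 28400 * z + 40000" "2 * t\<^sup>2 = z\<^sup>2 + 3 * z"
        using eq by (simp_all add: power2_eq_square algebra_simps)
      have "(7 * z)\<^sup>2 \<le> (10 * t)\<^sup>2" "(100 * t)\<^sup>2 \<le> (71 * z + 200)\<^sup>2"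
        unfolding sq(1-4) using sq(5) pos zero_le_power2 [of z] by linarith+
      then have "7 * z \<le> 10 * t" "100 * t \<le> 71 * z + 200"
        using power2_le_imp_le [of "7 * z" "10 * t"] power2_le_imp_le [of "100 * t" "71 * z + 200"]
          pos t0 by auto
      then have "t \<in> {7 * z div 10..71 * z div 100 + 2}" by auto
      moreover have "z \<in> {1..346}" using z pos 2 by simp
      ultimately have "(z, t) \<in> set [(3, 3), (24, 18), (147, 105)]"
        using bspec [OF bspec [OF pell_2_small [unfolded list_all_iff set_upto]]] eq by (simp del: list.set)
      then show ?thesis using 2 by auto
    next
      case 3
      then have eq: "3 * (z * (z + 4)) = 4 * t\<^sup>2" using area by (simp add: algebra_simps)
      have z: "z \<le> 250"
        by (rule semiperimeter_bound_1_3 [of z t u v w]) (use pos t t0 eq area' 3 in \<open>auto simp: add.commute\<close>)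
      have sq: "(86 * z)\<^sup>2 = 7396 * z\<^sup>2" "(100 * t)\<^sup>2 = 10000 * t\<^sup>2" "(100 * t)\<^sup>2 = 10000 * t\<^sup>2"
          "(87 * z + 200)\<^sup>2 = 7569 * z\<^sup>2 + 34800 * z + 40000" "4 * t\<^sup>2 = 3 * z\<^sup>2 + 12 * z"
        using eq by (simp_all add: power2_eq_square algebra_simps)
      have "(86 * z)\<^sup>2 \<le> (100 * t)\<^sup>2" "(100 * t)\<^sup>2 \<le> (87 * z + 200)\<^sup>2"
        unfolding sq(1-4) using sq(5) pos zero_le_power2 [of z] by linarith+
      then have "86 * z \<le> 100 * t" "100 * t \<le> 87 * z + 200"
        using power2_le_imp_le [of "86 * z" "100 * t"] power2_le_imp_le [of "100 * t" "87 * z + 200"]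
          pos t0 by auto
      then have "t \<in> {86 * z div 100..87 * z div 100 + 2}" by auto
      moreover have "z \<in> {3..250}" using z pos 3 by simp
      ultimately have "(z, t) \<in> set [(12, 12), (50, 45), (192, 168)]"
        using bspec [OF bspec [OF pell_3_small [unfolded list_all_iff set_upto]]] eq by (simp del: list.set)
      then show ?thesis using 3 by auto
    next
      case 4
      then have eq: "t\<^sup>2 = z * (z + 5)" using area by (simp add: algebra_simps)
      have "z\<^sup>2 < t\<^sup>2" "t\<^sup>2 < (z + 3)\<^sup>2"
        unfolding eq using pos by (simp_all add: power2_eq_square algebra_simps)
      then have "z < t" "t < z + 3"
        using power2_less_imp_less [of z t] power2_less_imp_less [of t "z + 3"] pos t0 by auto
      then have "t = z + 1 \<or> t = z + 2" by auto
      then have "t = z + 1 \<and> 3 * z = 1 \<or> t = z + 2 \<and> z = 4"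
        using eq by (auto simp: power2_eq_square algebra_simps)
      then have "t = 6 \<and> z = 4" by presburger
      then show ?thesis using 4 by simp
    next
      case 5
      then have eq: "t\<^sup>2 = z * (z + 4)" using area by (simp add: algebra_simps)
      have "z\<^sup>2 < t\<^sup>2" "t\<^sup>2 < (z + 2)\<^sup>2"
        unfolding eq using pos by (simp_all add: power2_eq_square algebra_simps)
      then have "z < t" "t < z + 2"
        using power2_less_imp_less [of z t] power2_less_imp_less [of t "z + 2"] pos t0 by auto
      then have "t = z + 1" by auto
      then have "2 * z = 1" using eq by (simp add: power2_eq_square algebra_simps)
      then have False by presburger
      then show ?thesis ..
    qed
  qed
qed

text \<open>By the second equation \<open>t\<close> divides \<open>4 * s^2\<close>, which eliminates
  five of the thirteen candidates; \<open>second_triangle_small\<close> settles the other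
  eight.\<close>

lemma amicable_tangent_lengths:
  fixes x y z u v w :: int
  assumes pos: "0 < x" "x \<le> y" "y \<le> z" "0 < u" "u \<le> v" "v \<le> w"
    and le: "u + v + w \<le> x + y + z"
    and area: "(x + y + z) * (x * y * z) = 4 * (u + v + w)\<^sup>2"
    and area': "(u + v + w) * (u * v * w) = 4 * (x + y + z)\<^sup>2"
  shows "(u, v, w) = (x, y, z) \<or> (x, y, z) = (1, 2, 24) \<and> (u, v, w) = (3, 6, 9)"
proof -
  define s t where "s = x + y + z" and "t = u + v + w"
  have dvd: "t dvd 4 * s\<^sup>2" unfolding s_def t_def area' [symmetric] by simp
  have uv: "u \<in> {1..t div 3}" "v \<in> {u..t div 2}" "w = t - u - v" "v \<le> t - u - v"
    using pos unfolding t_def by auto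
  have area'': "t * (u * v * (t - u - v)) = 4 * s\<^sup>2" using area' s_def t_def by simp
  have small: "(u, v, w) \<in> set L" if "(s, t, L) \<in> set [(6, 3, []), (27, 18, [(3, 6, 9)]),
      (9, 6, []), (30, 30, [(1, 5, 24)]), (21, 21, [(1, 6, 14)]), (18, 18, [(1, 8, 9)]),
      (15, 15, [(2, 3, 10)]), (12, 12, [(2, 4, 6)])]" for L
  proof -
    note bspec [OF second_triangle_small [unfolded list_all_iff set_upto] that]
    note bspec [OF this [unfolded prod.case] uv(1)]
    note bspec [OF this uv(2)]
    note iffD1 [OF if_P [OF conjI [OF area'' uv(4)]] this]
    then show ?thesis unfolding uv(3) .
  qed
  have "(x, y, z, t) \<in> {(1, 2, 3, 3), (1, 2, 24, 18), (1, 2, 147, 105), (1, 3, 12, 12),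
    (1, 3, 50, 45), (1, 3, 192, 168), (1, 4, 4, 6), (1, 5, 24, 30), (1, 6, 14, 21), (1, 8, 9, 18),
    (2, 3, 3, 6), (2, 3, 10, 15), (2, 4, 6, 12)}"
    by (rule tangent_lengths_cases [OF pos t_def])
      (use le area area' in \<open>simp_all only: t_def\<close>)
  then show ?thesis
    \<comment> \<open>The instance \<open>[(x, y, z)]\<close> serves the five candidates with
      \<open>s = t\<close>.\<close>
    using dvd small [of "[]"] small [of "[(3, 6, 9)]"] small [of "[(x, y, z)]"]
    unfolding s_def by (elim insertE emptyE) simp_all
qed

subsection \<open>Lattice triangles with rational perimeter\<close>

text \<open>Squaring \<open>x + y = q - z\<close> shows that \<open>r = x * y + q * z\<close> is
  rational. Squaring \<open>r - q * z = x * y\<close> then gives an equation linear in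
  \<open>z\<close> over the rationals, apart from the rational \<open>z^2\<close>; positivity makes
  its coefficient \<open>2 * r * q\<close> nonzero.\<close>

lemma Rats_summand_of_sqrts:
  fixes x y z :: real
  assumes pos: "0 < x" "0 < y" "0 < z"
    and sq: "x\<^sup>2 \<in> \<rat>" "y\<^sup>2 \<in> \<rat>" "z\<^sup>2 \<in> \<rat>" and sum: "x + y + z \<in> \<rat>"
  shows "z \<in> \<rat>"
proof -
  define q r where "q = x + y + z" and "r = x * y + q * z"
  have q: "q \<in> \<rat>" "q > 0" using sum pos by (simp_all add: q_def)
  have "r = (q\<^sup>2 + z\<^sup>2 - x\<^sup>2 - y\<^sup>2) / 2"
    by (simp add: r_def q_def power2_eq_square field_simps)
  also have "\<dots> \<in> \<rat>" using q sq by simp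
  finally have r: "r \<in> \<rat>" .
  have r0: "r > 0" using pos q by (simp add: r_def add_pos_pos)
  have "z = (r\<^sup>2 + q\<^sup>2 * z\<^sup>2 - x\<^sup>2 * y\<^sup>2) / (2 * r * q)"
    using q r0 by (simp add: field_simps) (simp add: r_def power2_eq_square algebra_simps)
  also have "\<dots> \<in> \<rat>"
    using q r sq by simp
  finally show ?thesis .
qed

lemma Rats_square_Ints:
  fixes z :: real
  assumes "z \<in> \<rat>" "z\<^sup>2 \<in> \<int>"
  shows "z \<in> \<int>"
proof -
  obtain m n :: int where mn: "n > 0" "coprime m n" "z = of_int m / of_int n"
    using Rats_cases' [OF assms(1)] by metis
  obtain k where "z\<^sup>2 = of_int k" using assms(2) by (auto elim: Ints_cases)
  then have "of_int (m\<^sup>2) = (of_int (k * n\<^sup>2) :: real)"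
    using mn by (simp add: field_simps)
  then have "m\<^sup>2 = k * n\<^sup>2" by (simp only: of_int_eq_iff)
  then have "n\<^sup>2 dvd m\<^sup>2" by simp
  then have "n dvd m" by simp
  then have "n = 1" using mn by (metis coprime_absorb_right is_unit_normalize normalize_int_def abs_of_pos)
  then show ?thesis using mn by simp
qed

lemma dist_power2_plane:
  fixes p q :: "real ^ 2"
  shows "(dist p q)\<^sup>2 = (p $ 1 - q $ 1)\<^sup>2 + (p $ 2 - q $ 2)\<^sup>2"
  by (simp add: dist_vec_def L2_set_def sum_2 dist_real_def)

text \<open>The determinant formula for the area is rational in the coordinates. Amicability
  transfers this to the perimeter of the other triangle.\<close>

lemma lattice_triangle_area_Rats:
  assumes "lattice_triangle T"
  shows "area T \<in> \<rat>"
proof -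
  obtain a b c where "lattice_point a" "lattice_point b" "lattice_point c" "T = convex hull {a, b, c}"
    using assms unfolding lattice_triangle_def by blast
  moreover have "p $ i \<in> \<rat>" if "lattice_point p" for p i
    using that Ints_subset_Rats unfolding lattice_point_def by blast
  ultimately show ?thesis
    by (auto simp: area_def content_triangle)
qed

lemma not_collinear_plane:
  fixes a b c :: "real ^ 2"
  assumes "(b $ 1 - a $ 1) * (c $ 2 - a $ 2) \<noteq> (b $ 2 - a $ 2) * (c $ 1 - a $ 1)"
  shows "\<not> collinear {a, b, c}"
proof
  assume "collinear {a, b, c}"
  then obtain u where u: "\<And>x y. x \<in> {a, b, c} \<Longrightarrow> y \<in> {a, b, c} \<Longrightarrow> \<exists>k. x - y = k *\<^sub>R u"
    unfolding collinear_def by blast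
  obtain k l where kl: "b - a = k *\<^sub>R u" "c - a = l *\<^sub>R u"
    using u [of b a] u [of c a] by auto
  have "b $ i - a $ i = k * u $ i" "c $ i - a $ i = l * u $ i" for i
    using arg_cong [OF kl(1), of "\<lambda>p. p $ i"] arg_cong [OF kl(2), of "\<lambda>p. p $ i"] by simp_all
  then show False using assms by simp
qed

text \<open>The side lengths determine all inner products of the edge vectors at \<open>a\<close>.
  These vectors form a basis, so the linear map sending them to the edge vectors at
  \<open>a'\<close> is an isometry; translations complete it.\<close>

lemma congruent_triangles_SSS:
  fixes a b c a' b' c' :: "real ^ 2"
  assumes ncol: "\<not> collinear {a, b, c}"
    and ab: "dist a' b' = dist a b" and bc: "dist b' c' = dist b c" and ca: "dist c' a' = dist c a"
  shows "congruent_figures (convex hull {a, b, c}) (convex hull {a', b', c'})"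
proof -
  define u v u' v' where uv: "u = b - a" "v = c - a" "u' = b' - a'" "v' = c' - a'"
  have ne: "a \<noteq> b" "b \<noteq> c" "a \<noteq> c" and ind: "\<not> affine_dependent {a, b, c}"
    using ncol unfolding collinear_3_eq_affine_dependent by blast+
  have "independent ((\<lambda>x. x - a) ` {b, c})"
    using ind ne affine_dependent_iff_dependent [of a "{b, c}"] by auto
  then have indep: "independent {u, v}" by (simp add: uv)
  have "u \<noteq> v" using ne by (simp add: uv)
  then have "UNIV \<subseteq> span {u, v}"
    by (intro card_ge_dim_independent [OF _ indep]) auto
  then have span: "x \<in> span {u, v}" for x by blast
  obtain f where f: "linear f" "f u = u'" "f v = v'"
    using linear_independent_extend [OF indep, of "\<lambda>x. if x = u then u' else v'"] \<open>u \<noteq> v\<close> by auto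
  have uu: "u' \<bullet> u' = u \<bullet> u" and vv: "v' \<bullet> v' = v \<bullet> v"
    using ab ca by (simp_all add: uv dist_norm norm_minus_commute dot_square_norm)
  have "(u' - v') \<bullet> (u' - v') = (u - v) \<bullet> (u - v)"
    using bc by (simp add: uv dist_norm dot_square_norm)
  then have uv': "u' \<bullet> v' = u \<bullet> v"
    using uu vv by (simp add: inner_diff inner_commute)
  have norm: "norm (f x) = norm x" for x
  proof -
    obtain \<alpha> where "x - \<alpha> *\<^sub>R u \<in> span {v}"
      using span [of x] unfolding span_breakdown_eq [of x u "{v}"] by blast
    then obtain \<beta> where "x - \<alpha> *\<^sub>R u = \<beta> *\<^sub>R v" by (auto simp: span_singleton)
    then have x: "x = \<alpha> *\<^sub>R u + \<beta> *\<^sub>R v" by (simp add: algebra_simps)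
    have "f x = \<alpha> *\<^sub>R u' + \<beta> *\<^sub>R v'"
      using f by (simp add: x linear_add linear_scale)
    then have "f x \<bullet> f x = x \<bullet> x"
      using uu vv uv' by (simp add: x inner_add inner_commute)
    then show ?thesis by (simp add: norm_eq)
  qed
  define g where "g x = a' + f (- a + x)" for x
  have "dist (g x) (g y) = dist x y" for x y
    using norm [of "x - y"] f(1) by (simp add: g_def dist_norm linear_add linear_diff linear_neg)
  moreover have "g ` (convex hull {a, b, c}) = convex hull {a', b', c'}"
  proof -
    have "g = (\<lambda>x. a' + x) \<circ> f \<circ> (\<lambda>x. - a + x)" by (auto simp: g_def)
    then have "g ` (convex hull {a, b, c}) = convex hull (g ` {a, b, c})"
      by (simp only: image_comp [symmetric] convex_hull_translation [symmetric]
        convex_hull_linear_image [OF f(1)])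
    also have "g ` {a, b, c} = {a', b', c'}"
      using f uv by (simp add: g_def linear_0)
    finally show ?thesis .
  qed
  ultimately show ?thesis unfolding congruent_figures_def by blast
qed

section \<open>Triangles described by their tangent lengths\<close>

text \<open>The parameters are the distances of the vertices from the points where the incircle touches
  the sides through them.\<close>

definition tangent_triangle :: "(real ^ 2) set \<Rightarrow> int \<Rightarrow> int \<Rightarrow> int \<Rightarrow> bool" where
  "tangent_triangle T x y z \<longleftrightarrow> 0 < x \<and> 0 < y \<and> 0 < z \<and>
    (\<exists>a b c. \<not> collinear {a, b, c} \<and> T = convex hull {a, b, c} \<and>
      dist a b = of_int (x + y) \<and> dist b c = of_int (y + z) \<and> dist c a = of_int (z + x))"

lemma tangent_triangle_rotate:
  assumes "tangent_triangle T x y z"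
  shows "tangent_triangle T y z x"
proof -
  obtain a b c where "\<not> collinear {b, c, a}" "T = convex hull {b, c, a}"
      "dist a b = of_int (x + y)" "dist b c = of_int (y + z)" "dist c a = of_int (z + x)"
    using assms unfolding tangent_triangle_def by (auto simp: insert_commute)
  then show ?thesis using assms unfolding tangent_triangle_def by blast
qed

lemma tangent_triangle_swap:
  assumes "tangent_triangle T x y z"
  shows "tangent_triangle T y x z"
proof -
  obtain a b c where "\<not> collinear {b, a, c}" "T = convex hull {b, a, c}"
      "dist b a = of_int (y + x)" "dist a c = of_int (x + z)" "dist c b = of_int (z + y)"
    using assms unfolding tangent_triangle_def
    by (auto simp: insert_commute dist_commute add.commute)
  then show ?thesis using assms unfolding tangent_triangle_def by blast
qed

text \<open>A rotation and a transposition generate all permutations of the vertices.\<close>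

lemma tangent_triangle_sorted:
  assumes "tangent_triangle T x y z"
  obtains x' y' z' where "tangent_triangle T x' y' z'" "x' \<le> y'" "y' \<le> z'"
  using assms tangent_triangle_rotate tangent_triangle_swap by (metis linorder_le_cases)

lemma perimeter_tangent_triangle:
  "tangent_triangle T x y z \<Longrightarrow> perimeter T = 2 * of_int (x + y + z)"
  unfolding tangent_triangle_def by (auto simp: perimeter_triangle)

text \<open>Heron's formula: the semiperimeter is \<open>x + y + z\<close>, and subtracting a side
  leaves the tangent length at the opposite vertex.\<close>

lemma area_tangent_triangle:
  assumes "tangent_triangle T x y z"
  shows "area T = sqrt (of_int ((x + y + z) * (x * y * z)))"
proof -
  obtain a b c where T: "T = convex hull {a, b, c}" and
      d: "dist a b = of_int (x + y)" "dist b c = of_int (y + z)" "dist c a = of_int (z + x)"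
    using assms unfolding tangent_triangle_def by blast
  have "area T = sqrt ((x + y + z) * (x + y + z - (y + z)) *
      (x + y + z - (z + x)) * (x + y + z - (x + y)))"
    using d by (simp add: T area_def heron dist_commute [of a c] field_simps)
  then show ?thesis by (simp add: algebra_simps)
qed

lemma congruent_tangent_triangles:
  assumes "tangent_triangle S x y z" "tangent_triangle T x y z"
  shows "congruent_figures S T"
  using assms unfolding tangent_triangle_def by (auto intro!: congruent_triangles_SSS)

text \<open>No two points of a triangle are farther apart than its longest side, and an isometry
  carries the side of length \<open>y + z\<close> to two points of \<open>T\<close>. This serves to
  refute congruence.\<close>

lemma congruent_tangent_triangles_longest_side:
  assumes S: "tangent_triangle S x y z" and T: "tangent_triangle T u v w"
    and le: "u \<le> v" "v \<le> w" and cong: "congruent_figures S T"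
  shows "y + z \<le> v + w"
proof -
  obtain b c where bc: "b \<in> S" "c \<in> S" "dist b c = of_int (y + z)"
    using S unfolding tangent_triangle_def by (metis hull_inc insertCI)
  obtain f where "\<And>x y. dist (f x) (f y) = dist x y" and "f ` S = T"
    using cong unfolding congruent_figures_def by blast
  with bc obtain b' c' where bc': "b' \<in> T" "c' \<in> T" "dist b' c' = of_int (y + z)"
    by (metis imageI)
  obtain p q r where "T = convex hull {p, q, r}"
      and d: "dist p q = of_int (u + v)" "dist q r = of_int (v + w)" "dist r p = of_int (w + u)"
      and pos: "0 < u" "0 < v" "0 < w"
    using T unfolding tangent_triangle_def by blast
  with bc' obtain s t where "s \<in> {p, q, r}" "t \<in> {p, q, r}" "dist b' c' \<le> dist s t"
    using simplex_extremal_le_exists [of "{p, q, r}" b' c'] unfolding dist_norm by blast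
  moreover have "dist s t \<le> of_int (v + w)" if "s \<in> {p, q, r}" "t \<in> {p, q, r}"
    using that d pos le by (auto simp: dist_commute)
  ultimately have "of_int (y + z) \<le> (of_int (v + w) :: real)" using bc' by simp
  then show ?thesis by (simp only: of_int_le_iff)
qed

lemma dist_lattice_points:
  assumes "lattice_point p" "lattice_point q"
  obtains h k :: int where "p $ 1 - q $ 1 = of_int h" "p $ 2 - q $ 2 = of_int k"
    "(dist p q)\<^sup>2 = of_int (h\<^sup>2 + k\<^sup>2)"
proof -
  have "p $ i - q $ i \<in> \<int>" for i
    using assms unfolding lattice_point_def by (intro Ints_diff) auto
  then obtain h k where hk: "p $ 1 - q $ 1 = of_int h" "p $ 2 - q $ 2 = of_int k"
    by (metis Ints_cases)
  show thesis
    by (rule that [OF hk]) (simp add: dist_power2_plane hk)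
qed

text \<open>Rational perimeter makes each side rational, hence an integer because its square is one.
  The tangent lengths are the semiperimeter minus the sides: integral since the perimeter is even,
  positive by the strict triangle inequality.\<close>

lemma lattice_triangle_tangent_triangle:
  assumes "lattice_triangle T" "perimeter T \<in> \<rat>"
  obtains x y z where "tangent_triangle T x y z"
proof -
  obtain a b c where lat: "lattice_point a" "lattice_point b" "lattice_point c"
    and ncol: "\<not> collinear {a, b, c}" and T: "T = convex hull {a, b, c}"
    using assms unfolding lattice_triangle_def by blast
  have ne: "a \<noteq> b" "b \<noteq> c" "c \<noteq> a"
    using ncol unfolding collinear_3_eq_affine_dependent by blast+
  obtain h1 k1 where 1: "a $ 1 - b $ 1 = of_int h1" "a $ 2 - b $ 2 = of_int k1"
      "(dist a b)\<^sup>2 = of_int (h1\<^sup>2 + k1\<^sup>2)"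
    using dist_lattice_points lat by metis
  obtain h2 k2 where 2: "b $ 1 - c $ 1 = of_int h2" "b $ 2 - c $ 2 = of_int k2"
      "(dist b c)\<^sup>2 = of_int (h2\<^sup>2 + k2\<^sup>2)"
    using dist_lattice_points lat by metis
  obtain h3 k3 where 3: "c $ 1 - a $ 1 = of_int h3" "c $ 2 - a $ 2 = of_int k3"
      "(dist c a)\<^sup>2 = of_int (h3\<^sup>2 + k3\<^sup>2)"
    using dist_lattice_points lat by metis
  have sum: "dist a b + dist b c + dist c a \<in> \<rat>"
    using assms(2) perimeter_triangle [OF ncol] T by simp
  have sq: "(dist a b)\<^sup>2 \<in> \<int>" "(dist b c)\<^sup>2 \<in> \<int>" "(dist c a)\<^sup>2 \<in> \<int>"
    unfolding 1 2 3 by (rule Ints_of_int)+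
  have "(dist a b)\<^sup>2 \<in> \<rat>" "(dist b c)\<^sup>2 \<in> \<rat>" "(dist c a)\<^sup>2 \<in> \<rat>"
    using sq Ints_subset_Rats by blast+
  then have "dist a b \<in> \<rat>" "dist b c \<in> \<rat>" "dist c a \<in> \<rat>"
    using Rats_summand_of_sqrts [of "dist b c" "dist c a" "dist a b"]
      Rats_summand_of_sqrts [of "dist c a" "dist a b" "dist b c"]
      Rats_summand_of_sqrts [of "dist a b" "dist b c" "dist c a"]
      sum ne by (simp_all add: add_ac)
  then have "dist a b \<in> \<int>" "dist b c \<in> \<int>" "dist c a \<in> \<int>"
    using sq Rats_square_Ints by blast+
  then obtain l m n where d: "dist a b = of_int l" "dist b c = of_int m" "dist c a = of_int n"
    by (metis Ints_cases)
  have "l\<^sup>2 = h1\<^sup>2 + k1\<^sup>2" "m\<^sup>2 = h2\<^sup>2 + k2\<^sup>2" "n\<^sup>2 = h3\<^sup>2 + k3\<^sup>2"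
    using 1(3) 2(3) 3(3) unfolding d of_int_power [symmetric] of_int_eq_iff by simp_all
  then have parity: "even l \<longleftrightarrow> even (h1 + k1)" "even m \<longleftrightarrow> even (h2 + k2)" "even n \<longleftrightarrow> even (h3 + k3)"
    by (metis even_add even_power zero_less_numeral)+
  \<comment> \<open>The edge vectors around the triangle sum to zero, and each side has the parity
    of the coordinate sum of its edge vector, so the perimeter is even.\<close>
  have "of_int (h1 + h2 + h3) = (0::real)" "of_int (k1 + k2 + k3) = (0::real)"
    using 1 2 3 by (simp_all flip: 1 2 3)
  then have "h1 + h2 + h3 = 0" "k1 + k2 + k3 = 0" by (simp_all only: of_int_eq_0_iff)
  then have "even (l + m + n)"
    using parity by presburger
  then obtain s where s: "l + m + n = 2 * s" by blast
  have "dist p r < dist p q + dist q r" if "{p, q, r} = {a, b, c}" for p q r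
  proof -
    \<comment> \<open>Equality in the triangle inequality would place \<open>q\<close> on the
      segment from \<open>p\<close> to \<open>r\<close>.\<close>
    have "\<not> between (p, r) q"
      using ncol that between_imp_collinear collinear_subset [of "{p, q, r}"]
      by (metis insert_commute)
    then show ?thesis
      using dist_triangle [of p r q] by (auto simp: between dist_commute)
  qed
  from this [of b a c] this [of a c b] this [of a b c]
  have "m < l + n" "l < m + n" "n < l + m"
    using d by (auto simp: dist_commute insert_commute simp flip: of_int_add)
  then have "tangent_triangle T (s - m) (s - n) (s - l)"
    unfolding tangent_triangle_def using s d ncol T by (intro conjI exI [of _ a] exI [of _ b] exI [of _ c]) auto
  then show thesis by (rule that)
qed

section \<open>Triangles given by coordinates\<close>

lemma tangent_triangle_vector:
  fixes a1 a2 b1 b2 c1 c2 :: real and x y z :: int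
  assumes "(b1 - a1) * (c2 - a2) \<noteq> (b2 - a2) * (c1 - a1)" "0 < x" "0 < y" "0 < z"
    and "(a1 - b1)\<^sup>2 + (a2 - b2)\<^sup>2 = (of_int (x + y))\<^sup>2"
    and "(b1 - c1)\<^sup>2 + (b2 - c2)\<^sup>2 = (of_int (y + z))\<^sup>2"
    and "(c1 - a1)\<^sup>2 + (c2 - a2)\<^sup>2 = (of_int (z + x))\<^sup>2"
  shows "tangent_triangle (convex hull {vector [a1, a2], vector [b1, b2], vector [c1, c2]}) x y z"
proof -
  have dist: "dist (vector [p, q] :: real ^ 2) (vector [p', q']) = of_int k"
    if "(p - p')\<^sup>2 + (q - q')\<^sup>2 = (of_int k)\<^sup>2" "0 < k" for p q p' q' and k :: int
    by (rule power2_eq_imp_eq) (use that in \<open>simp_all add: dist_power2_plane\<close>)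
  show ?thesis
    unfolding tangent_triangle_def
    using assms(1-4) dist [OF assms(5)] dist [OF assms(6)] dist [OF assms(7)]
    by (intro conjI exI not_collinear_plane) auto
qed

lemma lattice_triangle_vector:
  fixes a1 a2 b1 b2 c1 c2 :: int
  assumes "(b1 - a1) * (c2 - a2) \<noteq> (b2 - a2) * (c1 - a1)"
  shows "lattice_triangle (convex hull {vector [of_int a1, of_int a2],
    vector [of_int b1, of_int b2], vector [of_int c1, of_int c2]})"
proof -
  have "lattice_point (vector [of_int p, of_int q])" for p q
    unfolding lattice_point_def forall_2 by simp
  moreover have "\<not> collinear {vector [of_int a1, of_int a2] :: real ^ 2,
      vector [of_int b1, of_int b2], vector [of_int c1, of_int c2]}"
    by (rule not_collinear_plane)
      (use assms in \<open>simp only: vector_2 of_int_diff [symmetric] of_int_mult [symmetric] of_int_eq_iff not_False_eq_True\<close>)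
  ultimately show ?thesis unfolding lattice_triangle_def by blast
qed

subsection \<open>Amicable pairs\<close>

text \<open>The area is a square root by Heron's formula and the perimeter is twice an integer; both
  are positive, so squaring is reversible.\<close>

lemma amicable_tangent_triangles_iff:
  assumes S: "tangent_triangle S x y z" and T: "tangent_triangle T u v w"
  shows "amicable S T \<longleftrightarrow>
    (x + y + z) * (x * y * z) = 4 * (u + v + w)\<^sup>2 \<and> (u + v + w) * (u * v * w) = 4 * (x + y + z)\<^sup>2"
proof -
  have half: "sqrt (of_int k) = 2 * of_int m \<longleftrightarrow> k = 4 * m\<^sup>2" if "0 < k" "0 < m" for k m :: int
  proof -
    have "sqrt (of_int k) = 2 * of_int m \<longleftrightarrow> (of_int k :: real) = of_int (4 * m\<^sup>2)"
      using that by (subst real_sqrt_eq_iff [symmetric]) (simp add: real_sqrt_mult)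
    then show ?thesis by (simp only: of_int_eq_iff)
  qed
  have pos: "0 < x" "0 < y" "0 < z" "0 < u" "0 < v" "0 < w"
    using S T by (simp_all add: tangent_triangle_def)
  have "area S = perimeter T \<longleftrightarrow> (x + y + z) * (x * y * z) = 4 * (u + v + w)\<^sup>2"
    unfolding area_tangent_triangle [OF S] perimeter_tangent_triangle [OF T]
    by (rule half) (simp_all add: pos add_pos_pos)
  moreover have "area T = perimeter S \<longleftrightarrow> (u + v + w) * (u * v * w) = 4 * (x + y + z)\<^sup>2"
    unfolding area_tangent_triangle [OF T] perimeter_tangent_triangle [OF S]
    by (rule half) (simp_all add: pos add_pos_pos)
  ultimately show ?thesis unfolding amicable_def by metis
qed

text \<open>The arithmetic classification supposes that the first semiperimeter is the larger one;
  the two disjuncts come from which triangle has it.\<close>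

lemma amicable_lattice_triangles:
  assumes S: "lattice_triangle S" and T: "lattice_triangle T"
    and ncong: "\<not> congruent_figures S T" and amicable: "amicable S T"
  shows "tangent_triangle S 1 2 24 \<and> tangent_triangle T 3 6 9 \<or>
    tangent_triangle T 1 2 24 \<and> tangent_triangle S 3 6 9"
proof -
  have "perimeter S \<in> \<rat>" "perimeter T \<in> \<rat>"
    using lattice_triangle_area_Rats S T amicable unfolding amicable_def by metis+
  then obtain x y z u v w where
      x: "tangent_triangle S x y z" "x \<le> y" "y \<le> z" and
      u: "tangent_triangle T u v w" "u \<le> v" "v \<le> w"
    using S T lattice_triangle_tangent_triangle tangent_triangle_sorted by metis
  have pos: "0 < x" "0 < u" using x(1) u(1) by (simp_all add: tangent_triangle_def)
  have eqs: "(x + y + z) * (x * y * z) = 4 * (u + v + w)\<^sup>2"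
      "(u + v + w) * (u * v * w) = 4 * (x + y + z)\<^sup>2"
    using amicable amicable_tangent_triangles_iff [OF x(1) u(1)] by simp_all
  have ne: "(u, v, w) \<noteq> (x, y, z)"
    using ncong x(1) u(1) congruent_tangent_triangles by blast
  show ?thesis
  proof (cases "u + v + w \<le> x + y + z")
    case True
    then show ?thesis
      using amicable_tangent_lengths [OF pos(1) x(2,3) pos(2) u(2,3) _ eqs] ne x(1) u(1) by auto
  next
    case False
    then show ?thesis
      using amicable_tangent_lengths [OF pos(2) u(2,3) pos(1) x(2,3) _ eqs(2,1)] ne x(1) u(1) by auto
  qed
qed

theorem theorem1:
  shows "\<exists>T1 T2. lattice_triangle T1 \<and> lattice_triangle T2 \<and>
           \<not> congruent_figures T1 T2 \<and> amicable T1 T2 \<and>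
           (\<forall>T1' T2'. lattice_triangle T1' \<and> lattice_triangle T2' \<and>
              \<not> congruent_figures T1' T2' \<and> amicable T1' T2' \<longrightarrow>
              (congruent_figures T1' T1 \<and> congruent_figures T2' T2) \<or>
              (congruent_figures T1' T2 \<and> congruent_figures T2' T1))"
proof -
  \<comment> \<open>\<open>T1\<close> has sides 3, 26, 25, area 36 and perimeter 54;
    \<open>T2\<close> has sides 9, 15, 12, area 54 and perimeter 36. The \<open>of_int\<close> forms
    match \<open>lattice_triangle_vector\<close>.\<close>
  define T1 T2 :: "(real ^ 2) set" where
    "T1 = convex hull {vector [of_int 0, of_int 0], vector [of_int 3, of_int 0],
      vector [of_int (- 7), of_int 24]}" and
    "T2 = convex hull {vector [of_int 0, of_int 0], vector [of_int 9, of_int 0],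
      vector [of_int 0, of_int 12]}"
  have "lattice_triangle T1" "lattice_triangle T2"
    unfolding T1_def T2_def by (rule lattice_triangle_vector, simp)+
  moreover have T1: "tangent_triangle T1 1 2 24" and T2: "tangent_triangle T2 3 6 9"
    unfolding T1_def T2_def by (rule tangent_triangle_vector; simp)+
  \<comment> \<open>Congruence would give 26 \<le> 15 for the longest sides.\<close>
  moreover have "\<not> congruent_figures T1 T2"
    using congruent_tangent_triangles_longest_side [OF T1 T2] by auto
  moreover have "amicable T1 T2"
    unfolding amicable_tangent_triangles_iff [OF T1 T2] by simp
  moreover have "congruent_figures T1' T1 \<and> congruent_figures T2' T2 \<or>
      congruent_figures T1' T2 \<and> congruent_figures T2' T1"
    if "lattice_triangle T1'" "lattice_triangle T2'" "\<not> congruent_figures T1' T2'"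
      "amicable T1' T2'" for T1' T2'
    using amicable_lattice_triangles [OF that] congruent_tangent_triangles T1 T2 by blast
  ultimately show ?thesis by blast
qed

end
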